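(* Let $(G,\cdot,\rhd,\Phi)$ be a twisted post-group with sub-adjacent operation $\circ$. Then $$(G,\circ)\simeq (G_1,\circ)\oplus(K,\circ)$$ as semigroups, where $G_1=\{b\circ e_1\mid b\in G\}$, $K=\{e_a\mid a\in G\}$, and $\oplus$ denotes the direct product of semigroups.
   Context: A (left) twisted post-group $(G,\cdot,\rhd,\Phi)$ is a group $(G,\cdot)$ with identity $1$ and maps $\rhd:G\times G\to G$ and $\Phi:G\to G$ such that, setting $a\circ b=\Phi(a)\cdot(a\rhd b)$ (the sub-adjacent operation), for all $a,b,c\in G$: (1) $L_a^{\rhd}:G\to G$, $L_a^{\rhd}(b)=a\rhd b$, is a group automorphism of $(G,\cdot)$; (2) $(a\circ b)\rhd c=a\rhd(b\rhd c)$; (3) $\Phi(a\circ b)=a\circ\Phi(b)$. For $a\in G$ put $e_a=(L_a^{\rhd})^{-1}(\Phi(a)^{-1}\cdot a)$ (inverse of $\Phi(a)$ taken in $(G,\cdot)$); $e_1$ is the case $a=1$. The operation $\circ$ is associative, $(G_1,\circ)$ is a group, and $K$ is closed under $\circ$. *)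

theory Defs
  imports "HOL-Algebra.Group"
begin

definition subadj ::
    "('a, 'm) monoid_scheme \<Rightarrow> ('a \<Rightarrow> 'a \<Rightarrow> 'a) \<Rightarrow> ('a \<Rightarrow> 'a) \<Rightarrow> 'a \<Rightarrow> 'a \<Rightarrow> 'a"
  where "subadj G act \<Phi> a b = \<Phi> a \<otimes>\<^bsub>G\<^esub> act a b"

locale twisted_post_group = group G
  for G :: "('a, 'm) monoid_scheme" (structure) +
  fixes act :: "'a \<Rightarrow> 'a \<Rightarrow> 'a" (infixr \<open>\<rhd>\<close> 75)
    and \<Phi> :: "'a \<Rightarrow> 'a"
  assumes Phi_closed: "\<Phi> \<in> carrier G \<rightarrow> carrier G"
    and act_automorphism: "a \<in> carrier G \<Longrightarrow> (\<lambda>b. a \<rhd> b) \<in> iso G G"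
    and subadj_act:
      "\<lbrakk>a \<in> carrier G; b \<in> carrier G; c \<in> carrier G\<rbrakk>
        \<Longrightarrow> subadj G act \<Phi> a b \<rhd> c = a \<rhd> (b \<rhd> c)"
    and Phi_subadj:
      "\<lbrakk>a \<in> carrier G; b \<in> carrier G\<rbrakk>
        \<Longrightarrow> \<Phi> (subadj G act \<Phi> a b) = subadj G act \<Phi> a (\<Phi> b)"

definition tpg_e ::
    "('a, 'm) monoid_scheme \<Rightarrow> ('a \<Rightarrow> 'a \<Rightarrow> 'a) \<Rightarrow> ('a \<Rightarrow> 'a) \<Rightarrow> 'a \<Rightarrow> 'a"
  where "tpg_e G act \<Phi> a =
    inv_into (carrier G) (\<lambda>b. act a b) (inv\<^bsub>G\<^esub> (\<Phi> a) \<otimes>\<^bsub>G\<^esub> a)"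

definition tpg_G1 ::
    "('a, 'm) monoid_scheme \<Rightarrow> ('a \<Rightarrow> 'a \<Rightarrow> 'a) \<Rightarrow> ('a \<Rightarrow> 'a) \<Rightarrow> 'a set"
  where "tpg_G1 G act \<Phi> =
    {subadj G act \<Phi> b (tpg_e G act \<Phi> \<one>\<^bsub>G\<^esub>) | b. b \<in> carrier G}"

definition tpg_K ::
    "('a, 'm) monoid_scheme \<Rightarrow> ('a \<Rightarrow> 'a \<Rightarrow> 'a) \<Rightarrow> ('a \<Rightarrow> 'a) \<Rightarrow> 'a set"
  where "tpg_K G act \<Phi> = {tpg_e G act \<Phi> a | a. a \<in> carrier G}"

text \<open>A semigroup is encoded as a \<open>monoid\<close> record whose \<open>one\<close> field carries no meaning.
  The notions \<open>hom\<close>, \<open>iso\<close>, \<open>\<cong>\<close> of HOL-Algebra do not look at that field, so between such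
  records they are homomorphism and isomorphism of semigroups; the carrier and multiplication of
  \<open>\<times>\<times>\<close> do not depend on it either, so \<open>\<times>\<times>\<close> is the direct product of semigroups.\<close>

definition semigroup_on :: "'a set \<Rightarrow> ('a \<Rightarrow> 'a \<Rightarrow> 'a) \<Rightarrow> 'a monoid"
  where "semigroup_on S f = \<lparr>carrier = S, mult = f, one = undefined\<rparr>"

end

theory Submission
  imports Defs
begin

text \<open>For a fixed left factor, the sub-adjacent operation \<open>a \<circ> b = \<Phi> a \<cdot> (a \<rhd> b)\<close> is the
  automorphism \<open>L\<^sub>a\<close> followed by a left translation of the group. So \<open>b \<mapsto> a \<circ> b\<close> is a
  bijection, and \<open>e\<^sub>a\<close> is nothing but the solution \<open>x\<close> of \<open>a \<circ> x = a\<close>. The semigroup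
  \<open>(G, \<circ>)\<close> is therefore left cancellative and each element \<open>a\<close> has a right unit \<open>e\<^sub>a\<close> of its own.

  These two properties already force the splitting. Cancelling \<open>a\<close> in
  \<open>a \<circ> (e\<^sub>a \<circ> x) = a \<circ> x\<close> shows that every \<open>e\<^sub>a\<close> is a left identity of the whole
  semigroup. In particular \<open>e\<^sub>a \<circ> e\<^sub>b = e\<^sub>b\<close>, so \<open>K\<close> is a right zero semigroup. The
  isomorphism is \<open>a \<mapsto> (a \<circ> e\<^sub>1, e\<^sub>a)\<close>: the first component forgets the private right unit of
  \<open>a\<close>, and multiplying it by the second component restores \<open>a\<close>, because
  \<open>(a \<circ> e\<^sub>1) \<circ> e\<^sub>a = a \<circ> e\<^sub>a = a\<close>. This is the classical decomposition of a right group into a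
  group and a right zero semigroup.\<close>

locale left_cancel_local_units =
  fixes S :: "'a set"
    and mul :: "'a \<Rightarrow> 'a \<Rightarrow> 'a"  (infixl \<open>\<odot>\<close> 70)
    and e :: "'a \<Rightarrow> 'a"
  assumes mul_closed: "\<lbrakk>a \<in> S; b \<in> S\<rbrakk> \<Longrightarrow> a \<odot> b \<in> S"
    and mul_assoc: "\<lbrakk>a \<in> S; b \<in> S; c \<in> S\<rbrakk> \<Longrightarrow> (a \<odot> b) \<odot> c = a \<odot> (b \<odot> c)"
    and left_cancel: "\<lbrakk>a \<in> S; b \<in> S; c \<in> S; a \<odot> b = a \<odot> c\<rbrakk> \<Longrightarrow> b = c"
    and unit_closed: "a \<in> S \<Longrightarrow> e a \<in> S"
    and mul_unit: "a \<in> S \<Longrightarrow> a \<odot> e a = a"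
begin

lemma unit_left_identity:
  assumes "a \<in> S" "x \<in> S"
  shows "e a \<odot> x = x"
proof (rule left_cancel[of a])
  show "a \<odot> (e a \<odot> x) = a \<odot> x"
    using assms mul_assoc[of a "e a" x] by (simp add: unit_closed mul_unit)
qed (use assms in \<open>simp_all add: mul_closed unit_closed\<close>)

text \<open>By left cancellation an element has only one right unit, and the right unit of the right
  factor is one for the product.\<close>

lemma unit_mul:
  assumes "a \<in> S" "b \<in> S"
  shows "e (a \<odot> b) = e b"
proof (rule left_cancel[of "a \<odot> b"])
  show "(a \<odot> b) \<odot> e (a \<odot> b) = (a \<odot> b) \<odot> e b"
    using assms by (simp add: mul_closed mul_unit mul_assoc[of a b "e b"] unit_closed)
qed (use assms in \<open>simp_all add: mul_closed unit_closed\<close>)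

text \<open>Since \<open>e c\<close> is a right unit of itself, right multiplication by \<open>e c\<close> imposes \<open>e c\<close> as
  the right unit.\<close>

lemma unit_mul_unit:
  assumes "a \<in> S" "c \<in> S"
  shows "e (a \<odot> e c) = e c"
proof -
  have "e (e c) = e c"
    using unit_mul[OF assms(2) unit_closed[OF assms(2)]] mul_unit[OF assms(2)] by simp
  then show ?thesis
    using unit_mul[OF assms(1) unit_closed[OF assms(2)]] by simp
qed

text \<open>The base point \<open>p\<close> is arbitrary, because all the right units act identically from the left.\<close>

lemma iso_unit_decomposition:
  assumes p: "p \<in> S"
  shows "(\<lambda>a. (a \<odot> e p, e a)) \<in>
    iso (semigroup_on S (\<odot>))
        (semigroup_on {b \<odot> e p | b. b \<in> S} (\<odot>) \<times>\<times> semigroup_on {e a | a. a \<in> S} (\<odot>))"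
proof (rule isoI)
  have absorb: "(a \<odot> e c) \<odot> x = a \<odot> x" if "a \<in> S" "c \<in> S" "x \<in> S" for a c x
    using that by (simp add: mul_assoc unit_closed unit_left_identity)
  have "(a \<odot> b) \<odot> e p = (a \<odot> e p) \<odot> (b \<odot> e p)" "e (a \<odot> b) = e a \<odot> e b"
    if "a \<in> S" "b \<in> S" for a b
    using that p by (simp_all add: absorb mul_assoc mul_closed unit_closed unit_mul
        unit_left_identity)
  then show "(\<lambda>a. (a \<odot> e p, e a)) \<in>
    hom (semigroup_on S (\<odot>))
        (semigroup_on {b \<odot> e p | b. b \<in> S} (\<odot>) \<times>\<times> semigroup_on {e a | a. a \<in> S} (\<odot>))"
    by (auto simp: hom_def semigroup_on_def DirProd_def)
  have "inj_on (\<lambda>a. (a \<odot> e p, e a)) S"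
  proof (rule inj_onI)
    fix a b assume ab: "a \<in> S" "b \<in> S" and eq: "(a \<odot> e p, e a) = (b \<odot> e p, e b)"
    have "a = (a \<odot> e p) \<odot> e a" "b = (b \<odot> e p) \<odot> e b"
      using ab p by (simp_all add: absorb unit_closed mul_unit)
    with eq show "a = b" by simp
  qed
  moreover have "(b \<odot> e p, e c) \<in> (\<lambda>a. (a \<odot> e p, e a)) ` S" if "b \<in> S" "c \<in> S" for b c
  proof (rule image_eqI[of _ _ "b \<odot> e c"])
    show "(b \<odot> e p, e c) = ((b \<odot> e c) \<odot> e p, e (b \<odot> e c))"
      using that p by (simp add: absorb unit_closed unit_mul_unit)
  qed (use that in \<open>simp add: mul_closed unit_closed\<close>)
  ultimately show "bij_betw (\<lambda>a. (a \<odot> e p, e a)) (carrier (semigroup_on S (\<odot>)))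
    (carrier (semigroup_on {b \<odot> e p | b. b \<in> S} (\<odot>) \<times>\<times> semigroup_on {e a | a. a \<in> S} (\<odot>)))"
    by (auto simp: bij_betw_def semigroup_on_def DirProd_def)
qed

end

context twisted_post_group
begin

lemma Phi_in_carrier: "a \<in> carrier G \<Longrightarrow> \<Phi> a \<in> carrier G"
  using Phi_closed by blast

lemma act_bij: "a \<in> carrier G \<Longrightarrow> bij_betw (\<lambda>b. a \<rhd> b) (carrier G) (carrier G)"
  using act_automorphism by (simp add: iso_def)

lemma act_closed: "\<lbrakk>a \<in> carrier G; b \<in> carrier G\<rbrakk> \<Longrightarrow> a \<rhd> b \<in> carrier G"
  using act_bij bij_betwE by blast

lemma act_mult:
  "\<lbrakk>a \<in> carrier G; b \<in> carrier G; c \<in> carrier G\<rbrakk> \<Longrightarrow> a \<rhd> (b \<otimes> c) = (a \<rhd> b) \<otimes> (a \<rhd> c)"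
  using act_automorphism[of a] by (simp add: iso_def hom_mult[of "\<lambda>b. a \<rhd> b"])

lemma subadj_closed:
  "\<lbrakk>a \<in> carrier G; b \<in> carrier G\<rbrakk> \<Longrightarrow> subadj G act \<Phi> a b \<in> carrier G"
  by (simp add: subadj_def Phi_in_carrier act_closed)

text \<open>The three axioms combine as
  \<open>(a \<circ> b) \<circ> c = (a \<circ> \<Phi> b) \<cdot> (a \<rhd> (b \<rhd> c)) = \<Phi> a \<cdot> (a \<rhd> (\<Phi> b \<cdot> (b \<rhd> c))) = a \<circ> (b \<circ> c)\<close>.\<close>

lemma subadj_assoc:
  assumes "a \<in> carrier G" "b \<in> carrier G" "c \<in> carrier G"
  shows "subadj G act \<Phi> (subadj G act \<Phi> a b) c = subadj G act \<Phi> a (subadj G act \<Phi> b c)"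
proof -
  have "subadj G act \<Phi> (subadj G act \<Phi> a b) c
      = subadj G act \<Phi> a (\<Phi> b) \<otimes> (a \<rhd> (b \<rhd> c))"
    using assms by (simp add: subadj_def[of G act \<Phi> "subadj G act \<Phi> a b"] Phi_subadj subadj_act)
  also have "\<dots> = subadj G act \<Phi> a (subadj G act \<Phi> b c)"
    using assms by (simp add: subadj_def m_assoc act_mult act_closed Phi_in_carrier)
  finally show ?thesis .
qed

lemma subadj_left_cancel:
  assumes "a \<in> carrier G" "b \<in> carrier G" "c \<in> carrier G"
    and "subadj G act \<Phi> a b = subadj G act \<Phi> a c"
  shows "b = c"
proof -
  have "a \<rhd> b = a \<rhd> c"
    using assms by (simp add: subadj_def Phi_in_carrier act_closed)
  then show ?thesis
    using bij_betw_imp_inj_on[OF act_bij[OF assms(1)]] assms by (simp add: inj_on_eq_iff)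
qed

lemma tpg_e_closed: "a \<in> carrier G \<Longrightarrow> tpg_e G act \<Phi> a \<in> carrier G"
  unfolding tpg_e_def
  by (rule inv_into_into) (simp add: bij_betw_imp_surj_on[OF act_bij] Phi_in_carrier)

lemma subadj_tpg_e:
  assumes "a \<in> carrier G"
  shows "subadj G act \<Phi> a (tpg_e G act \<Phi> a) = a"
proof -
  have "a \<rhd> tpg_e G act \<Phi> a = inv \<Phi> a \<otimes> a"
    unfolding tpg_e_def using assms
    by (intro bij_betw_inv_into_right[OF act_bij]) (simp_all add: Phi_in_carrier)
  then show ?thesis
    using assms by (simp add: subadj_def Phi_in_carrier m_assoc[symmetric])
qed

sublocale subadj: left_cancel_local_units "carrier G" "subadj G act \<Phi>" "tpg_e G act \<Phi>"
  by unfold_locales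
    (simp_all add: subadj_closed subadj_assoc tpg_e_closed subadj_tpg_e,
     blast intro: subadj_left_cancel)

end

theorem theorem3p5:
  fixes G :: "('a, 'm) monoid_scheme"
    and act :: "'a \<Rightarrow> 'a \<Rightarrow> 'a"
    and \<Phi> :: "'a \<Rightarrow> 'a"
  assumes "twisted_post_group G act \<Phi>"
  shows "semigroup_on (carrier G) (subadj G act \<Phi>)
    \<cong> semigroup_on (tpg_G1 G act \<Phi>) (subadj G act \<Phi>)
        \<times>\<times> semigroup_on (tpg_K G act \<Phi>) (subadj G act \<Phi>)"
proof -
  interpret twisted_post_group G act \<Phi> by (rule assms)
  show ?thesis
    unfolding tpg_G1_def tpg_K_def
    by (rule is_isoI) (rule subadj.iso_unit_decomposition[OF one_closed])
qed

end
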